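(* Let $R$ be an associative ring with identity and let $n\ge 1$. An element $[B\,|\,A]\in L_n(R)$ is the maximum element $1_n$ of the partial order $L_n(R)$ if and only if there exists a matrix $W$ over $R$ such that $BW=A$.
   Context: $R$ is an associative, not necessarily commutative, ring with identity. For $n\ge 1$, $L'_n(R)$ is the collection of pairs $(B\,|\,A)$ of matrices with entries in $R$ such that $A$ has $n$ columns and $B$ has the same number of rows as $A$ (the number of rows, and the number of columns of $B$, are arbitrary). The relation $(B\,|\,A)\le_n (B'\,|\,A')$ holds in $L'_n(R)$ if there exist matrices $U,V,G$ over $R$, of appropriate size, such that $UB=B'V$ and $UA=A'+B'G$. This is a pre-order; write $(B\,|\,A)\approx_n(B'\,|\,A')$ if both $(B\,|\,A)\le_n(B'\,|\,A')$ and $(B'\,|\,A')\le_n(B\,|\,A)$. $L_n(R)$ is the set of equivalence classes $[B\,|\,A]$ of $\approx_n$, with the induced partial order. Its maximum element is $1_n=[1\,|\,\mathbf 0]$, where $1$ is the $1\times 1$ identity matrix and $\mathbf 0$ is the $1\times n$ zero matrix. *)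

theory Defs
  imports "Jordan_Normal_Form.Matrix"
begin

text \<open>
  The coefficient ring has sort \<open>{ring, monoid_mult}\<close>, that is, associative with identity and
  not necessarily commutative. The class \<open>ring_1\<close> would in addition require \<open>0 \<noteq> 1\<close> and so
  exclude the zero ring.

  A pair \<open>(B | A)\<close> is represented by \<open>(B, A)\<close>. The numbers of rows and of columns of \<open>B\<close> may be
  zero.
\<close>

definition L_pairs :: "nat \<Rightarrow> ('a :: {ring, monoid_mult} mat \<times> 'a mat) set" where
  "L_pairs n = {(B, A). dim_col A = n \<and> dim_row B = dim_row A}"

text \<open>
  Addition of \<^typ>\<open>'a mat\<close> is total, so the sizes of \<open>U\<close>, \<open>V\<close>, \<open>G\<close> are spelled out; they are the
  only ones for which both equations make sense.
\<close>

definition L_preorder ::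
  "nat \<Rightarrow> (('a :: {ring, monoid_mult} mat \<times> 'a mat) \<times> ('a mat \<times> 'a mat)) set" where
  "L_preorder n = {((B, A), (B', A')).
     (B, A) \<in> L_pairs n \<and> (B', A') \<in> L_pairs n \<and>
     (\<exists>U V G. U \<in> carrier_mat (dim_row B') (dim_row B) \<and>
              V \<in> carrier_mat (dim_col B') (dim_col B) \<and>
              G \<in> carrier_mat (dim_col B') n \<and>
              U * B = B' * V \<and> U * A = A' + B' * G)}"

definition L_equiv ::
  "nat \<Rightarrow> (('a :: {ring, monoid_mult} mat \<times> 'a mat) \<times> ('a mat \<times> 'a mat)) set" where
  "L_equiv n = L_preorder n \<inter> (L_preorder n)\<inverse>"

definition L_set :: "nat \<Rightarrow> ('a :: {ring, monoid_mult} mat \<times> 'a mat) set set" where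
  "L_set n = L_pairs n // L_equiv n"

definition L_class ::
  "nat \<Rightarrow> 'a :: {ring, monoid_mult} mat \<Rightarrow> 'a mat \<Rightarrow> ('a mat \<times> 'a mat) set" where
  "L_class n B A = L_equiv n `` {(B, A)}"

definition L_order ::
  "nat \<Rightarrow> (('a :: {ring, monoid_mult} mat \<times> 'a mat) set \<times> ('a mat \<times> 'a mat) set) set" where
  "L_order n = {(X, Y). X \<in> L_set n \<and> Y \<in> L_set n \<and> (\<exists>p\<in>X. \<exists>q\<in>Y. (p, q) \<in> L_preorder n)}"

definition L_one :: "nat \<Rightarrow> ('a :: {ring, monoid_mult} mat \<times> 'a mat) set" where
  "L_one n = L_class n (1\<^sub>m 1) (0\<^sub>m 1 n)"

text \<open>The library states the unit laws only for \<open>semiring_1\<close>, which excludes the zero ring.\<close>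

lemma one_mat_mult_left:
  fixes M :: "'a :: {ring, monoid_mult} mat"
  shows "1\<^sub>m (dim_row M) * M = M"
proof (rule eq_matI)
  fix i j assume ij: "i < dim_row M" "j < dim_col M"
  have "(1\<^sub>m (dim_row M) * M) $$ (i, j) = (\<Sum>k = 0..<dim_row M. (if i = k then 1 else 0) * M $$ (k, j))"
    using ij by (simp add: scalar_prod_def)
  also have "\<dots> = (\<Sum>k = 0..<dim_row M. if i = k then M $$ (k, j) else 0)"
    by (rule sum.cong) simp_all
  also have "\<dots> = M $$ (i, j)" using ij by simp
  finally show "(1\<^sub>m (dim_row M) * M) $$ (i, j) = M $$ (i, j)" .
qed auto

lemma one_mat_mult_right:
  fixes M :: "'a :: {ring, monoid_mult} mat"
  shows "M * 1\<^sub>m (dim_col M) = M"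
proof (rule eq_matI)
  fix i j assume ij: "i < dim_row M" "j < dim_col M"
  have "(M * 1\<^sub>m (dim_col M)) $$ (i, j) = (\<Sum>k = 0..<dim_col M. M $$ (i, k) * (if k = j then 1 else 0))"
    using ij by (simp add: scalar_prod_def)
  also have "\<dots> = (\<Sum>k = 0..<dim_col M. if k = j then M $$ (i, k) else 0)"
    by (rule sum.cong) simp_all
  also have "\<dots> = M $$ (i, j)" using ij by simp
  finally show "(M * 1\<^sub>m (dim_col M)) $$ (i, j) = M $$ (i, j)" .
qed auto

lemma L_preorder_iff:
  "((B, A), (B', A')) \<in> L_preorder n \<longleftrightarrow>
     (B, A) \<in> L_pairs n \<and> (B', A') \<in> L_pairs n \<and>
     (\<exists>U V G. U \<in> carrier_mat (dim_row B') (dim_row B) \<and>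
              V \<in> carrier_mat (dim_col B') (dim_col B) \<and>
              G \<in> carrier_mat (dim_col B') n \<and>
              U * B = B' * V \<and> U * A = A' + B' * G)"
  unfolding L_preorder_def mem_Collect_eq prod.case ..

lemma L_preorder_refl:
  assumes "p \<in> L_pairs n"
  shows "(p, p) \<in> L_preorder n"
proof -
  obtain B A where p: "p = (B, A)" by (cases p)
  have d: "dim_col A = n" "dim_row B = dim_row A" using assms p by (auto simp: L_pairs_def)
  have A: "A \<in> carrier_mat (dim_row A) n" and B: "B \<in> carrier_mat (dim_row B) (dim_col B)"
    using d(1) by auto
  have "1\<^sub>m (dim_row B) * B = B * 1\<^sub>m (dim_col B)"
    by (simp only: one_mat_mult_left one_mat_mult_right)
  moreover have "1\<^sub>m (dim_row B) * A = A + B * 0\<^sub>m (dim_col B) n"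
    by (simp only: right_mult_zero_mat[OF B] d(2) one_mat_mult_left right_add_zero_mat[OF A])
  moreover have "1\<^sub>m (dim_row B) \<in> carrier_mat (dim_row B) (dim_row B)"
    "1\<^sub>m (dim_col B) \<in> carrier_mat (dim_col B) (dim_col B)"
    "0\<^sub>m (dim_col B) n \<in> carrier_mat (dim_col B) n"
    by auto
  ultimately show ?thesis
    using assms unfolding p L_preorder_iff by blast
qed

lemma L_preorder_trans:
  assumes "(p, q) \<in> L_preorder n" and "(q, r) \<in> L_preorder n"
  shows "(p, r) \<in> L_preorder n"
proof -
  obtain B A B' A' B'' A'' where e: "p = (B, A)" "q = (B', A')" "r = (B'', A'')"
    by (cases p, cases q, cases r) blast
  have L: "(B, A) \<in> L_pairs n" "(B', A') \<in> L_pairs n" "(B'', A'') \<in> L_pairs n"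
    using assms unfolding e L_preorder_iff by simp_all
  have cB: "B \<in> carrier_mat (dim_row B) (dim_col B)"
    "B' \<in> carrier_mat (dim_row B') (dim_col B')"
    "B'' \<in> carrier_mat (dim_row B'') (dim_col B'')"
    by auto
  have cA: "A \<in> carrier_mat (dim_row B) n" "A' \<in> carrier_mat (dim_row B') n"
    "A'' \<in> carrier_mat (dim_row B'') n"
    using L by (auto simp: L_pairs_def)
  obtain U V G where
    U: "U \<in> carrier_mat (dim_row B') (dim_row B)" and
    V: "V \<in> carrier_mat (dim_col B') (dim_col B)" and
    G: "G \<in> carrier_mat (dim_col B') n" and
    UB: "U * B = B' * V" and UA: "U * A = A' + B' * G"
    using assms(1) unfolding e L_preorder_iff by blast
  obtain U' V' G' where
    U': "U' \<in> carrier_mat (dim_row B'') (dim_row B')" and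
    V': "V' \<in> carrier_mat (dim_col B'') (dim_col B')" and
    G': "G' \<in> carrier_mat (dim_col B'') n" and
    UB': "U' * B' = B'' * V'" and UA': "U' * A' = A'' + B'' * G'"
    using assms(2) unfolding e L_preorder_iff by blast
  have "(U' * U) * B = U' * (B' * V)" using assoc_mult_mat[OF U' U cB(1)] UB by simp
  also have "\<dots> = (B'' * V') * V" using assoc_mult_mat[OF U' cB(2) V] UB' by simp
  also have "\<dots> = B'' * (V' * V)" by (rule assoc_mult_mat[OF cB(3) V' V])
  finally have 1: "(U' * U) * B = B'' * (V' * V)" .
  have B'G: "B' * G \<in> carrier_mat (dim_row B') n" using cB(2) G by (rule mult_carrier_mat)
  have V'G: "V' * G \<in> carrier_mat (dim_col B'') n" using V' G by (rule mult_carrier_mat)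
  have "(U' * U) * A = U' * (A' + B' * G)" using assoc_mult_mat[OF U' U cA(1)] UA by simp
  also have "\<dots> = U' * A' + U' * (B' * G)" by (rule mult_add_distrib_mat[OF U' cA(2) B'G])
  also have "U' * (B' * G) = (B'' * V') * G" using assoc_mult_mat[OF U' cB(2) G] UB' by simp
  also have "\<dots> = B'' * (V' * G)" by (rule assoc_mult_mat[OF cB(3) V' G])
  also have "U' * A' + B'' * (V' * G) = A'' + (B'' * G' + B'' * (V' * G))"
    unfolding UA'
    by (rule assoc_add_mat[OF cA(3) mult_carrier_mat[OF cB(3) G'] mult_carrier_mat[OF cB(3) V'G]])
  also have "B'' * G' + B'' * (V' * G) = B'' * (G' + V' * G)"
    by (rule mult_add_distrib_mat[OF cB(3) G' V'G, symmetric])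
  finally have 2: "(U' * U) * A = A'' + B'' * (G' + V' * G)" .
  have "U' * U \<in> carrier_mat (dim_row B'') (dim_row B)" using U' U by (rule mult_carrier_mat)
  moreover have "V' * V \<in> carrier_mat (dim_col B'') (dim_col B)" using V' V by (rule mult_carrier_mat)
  moreover have "G' + V' * G \<in> carrier_mat (dim_col B'') n" using V'G by (rule add_carrier_mat)
  ultimately show ?thesis using L 1 2 unfolding e L_preorder_iff by blast
qed

lemma L_preorder_preorder_on:
  "preorder_on (L_pairs n :: ('a :: {ring, monoid_mult} mat \<times> 'a mat) set) (L_preorder n)"
  (is "preorder_on ?P ?r")
  unfolding preorder_on_def
proof (intro conjI)
  show "?r \<subseteq> ?P \<times> ?P"
  proof (rule subrelI)
    fix p q :: "'a mat \<times> 'a mat"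
    assume "(p, q) \<in> L_preorder n"
    then show "(p, q) \<in> L_pairs n \<times> L_pairs n"
      by (cases p, cases q) (simp add: L_preorder_iff)
  qed
  show "refl_on ?P ?r" by (rule refl_onI) (rule L_preorder_refl)
  show "trans ?r" by (rule transI) (rule L_preorder_trans)
qed

lemma L_equiv_equiv:
  "equiv (L_pairs n :: ('a :: {ring, monoid_mult} mat \<times> 'a mat) set) (L_equiv n)"
  (is "equiv ?P ?r")
proof (rule equivI)
  show "?r \<subseteq> ?P \<times> ?P"
  proof (rule subrelI)
    fix p q :: "'a mat \<times> 'a mat"
    assume "(p, q) \<in> L_equiv n"
    then have "(p, q) \<in> L_preorder n" by (simp add: L_equiv_def)
    then show "(p, q) \<in> L_pairs n \<times> L_pairs n"
      by (cases p, cases q) (simp add: L_preorder_iff)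
  qed
  show "refl_on ?P ?r"
  proof (rule refl_onI)
    fix p :: "'a mat \<times> 'a mat"
    assume "p \<in> L_pairs n"
    from L_preorder_refl[OF this] show "(p, p) \<in> L_equiv n" by (simp add: L_equiv_def)
  qed
  show "sym ?r"
    by (rule symI) (simp add: L_equiv_def)
  show "trans ?r"
  proof (rule transI)
    fix p q r :: "'a mat \<times> 'a mat"
    assume "(p, q) \<in> L_equiv n" "(q, r) \<in> L_equiv n"
    then have "(p, q) \<in> L_preorder n" "(q, p) \<in> L_preorder n"
      "(q, r) \<in> L_preorder n" "(r, q) \<in> L_preorder n"
      by (simp_all add: L_equiv_def)
    then show "(p, r) \<in> L_equiv n"
      using L_preorder_trans[of p q n r] L_preorder_trans[of r q n p] by (simp add: L_equiv_def)
  qed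
qed

lemma L_class_in_L_set: "(B, A) \<in> L_pairs n \<Longrightarrow> L_class n B A \<in> L_set n"
  unfolding L_class_def L_set_def by (rule quotientI)

lemma L_setE:
  assumes "X \<in> L_set n"
  obtains B A where "(B, A) \<in> L_pairs n" "X = L_class n B A"
proof -
  obtain p where p: "p \<in> L_pairs n" "X = L_equiv n `` {p}"
    using assms unfolding L_set_def quotient_def by blast
  moreover obtain B A where "p = (B, A)" by (cases p)
  ultimately show thesis using that[of B A] by (simp add: L_class_def)
qed

lemma L_order_class_iff:
  assumes "(B, A) \<in> L_pairs n" "(B', A') \<in> L_pairs n"
  shows "(L_class n B A, L_class n B' A') \<in> L_order n \<longleftrightarrow> ((B, A), (B', A')) \<in> L_preorder n"
proof
  assume "(L_class n B A, L_class n B' A') \<in> L_order n"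
  then obtain p q where "((B, A), p) \<in> L_equiv n" "((B', A'), q) \<in> L_equiv n" "(p, q) \<in> L_preorder n"
    by (auto simp: L_order_def L_class_def)
  then have "((B, A), p) \<in> L_preorder n" "(p, q) \<in> L_preorder n" "(q, (B', A')) \<in> L_preorder n"
    by (simp_all add: L_equiv_def)
  then show "((B, A), (B', A')) \<in> L_preorder n"
    by (meson L_preorder_trans)
next
  assume "((B, A), (B', A')) \<in> L_preorder n"
  moreover have "(B, A) \<in> L_class n B A" "(B', A') \<in> L_class n B' A'"
    unfolding L_class_def by (rule equiv_class_self[OF L_equiv_equiv], rule assms)+
  ultimately show "(L_class n B A, L_class n B' A') \<in> L_order n"
    unfolding L_order_def mem_Collect_eq prod.case
    using L_class_in_L_set[OF assms(1)] L_class_in_L_set[OF assms(2)] by blast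
qed

lemma L_class_eq_iff:
  assumes "(B, A) \<in> L_pairs n" "(B', A') \<in> L_pairs n"
  shows "L_class n B A = L_class n B' A' \<longleftrightarrow> ((B, A), (B', A')) \<in> L_equiv n"
  unfolding L_class_def by (rule eq_equiv_class_iff[OF L_equiv_equiv assms])

lemma L_order_partial_order_on:
  "partial_order_on (L_set n :: ('a :: {ring, monoid_mult} mat \<times> 'a mat) set set) (L_order n)"
  (is "partial_order_on ?P ?r")
  unfolding partial_order_on_def preorder_on_def
proof (intro conjI)
  show "?r \<subseteq> ?P \<times> ?P" by (auto simp: L_order_def)
  show "refl_on ?P ?r"
  proof (rule refl_onI)
    fix X :: "('a mat \<times> 'a mat) set"
    assume "X \<in> L_set n"
    then obtain B A where BA: "(B, A) \<in> L_pairs n" "X = L_class n B A" by (rule L_setE)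
    then show "(X, X) \<in> L_order n"
      using L_order_class_iff[OF BA(1) BA(1)] L_preorder_refl[OF BA(1)] by simp
  qed
  show "trans ?r"
  proof (rule transI)
    fix X Y Z :: "('a mat \<times> 'a mat) set"
    assume XY: "(X, Y) \<in> L_order n" and YZ: "(Y, Z) \<in> L_order n"
    then have "X \<in> L_set n" "Y \<in> L_set n" "Z \<in> L_set n" by (auto simp: L_order_def)
    then obtain B A B' A' B'' A'' where
      x: "(B, A) \<in> L_pairs n" "X = L_class n B A" and
      y: "(B', A') \<in> L_pairs n" "Y = L_class n B' A'" and
      z: "(B'', A'') \<in> L_pairs n" "Z = L_class n B'' A''"
      by (elim L_setE) blast
    have "((B, A), (B'', A'')) \<in> L_preorder n"
      using XY YZ L_order_class_iff[OF x(1) y(1)] L_order_class_iff[OF y(1) z(1)]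
        L_preorder_trans[of "(B, A)" "(B', A')" n "(B'', A'')"]
      by (simp only: x(2) y(2) z(2))
    then show "(X, Z) \<in> L_order n" using L_order_class_iff[OF x(1) z(1)] x(2) z(2) by simp
  qed
  show "antisym ?r"
  proof (rule antisymI)
    fix X Y :: "('a mat \<times> 'a mat) set"
    assume XY: "(X, Y) \<in> L_order n" and YX: "(Y, X) \<in> L_order n"
    then have "X \<in> L_set n" "Y \<in> L_set n" by (auto simp: L_order_def)
    then obtain B A B' A' where
      x: "(B, A) \<in> L_pairs n" "X = L_class n B A" and
      y: "(B', A') \<in> L_pairs n" "Y = L_class n B' A'"
      by (elim L_setE) blast
    have "((B, A), (B', A')) \<in> L_equiv n"
      using XY YX L_order_class_iff[OF x(1) y(1)] L_order_class_iff[OF y(1) x(1)]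
      by (simp only: x(2) y(2) L_equiv_def Int_iff converse_iff)
    then show "X = Y" using L_class_eq_iff[OF x(1) y(1)] x(2) y(2) by simp
  qed
qed

lemma L_one_pair: "(1\<^sub>m 1, 0\<^sub>m 1 n) \<in> L_pairs n"
  by (simp add: L_pairs_def)

lemma L_one_in_L_set: "L_one n \<in> L_set n"
  unfolding L_one_def by (rule L_class_in_L_set[OF L_one_pair])

lemma L_one_greatest:
  fixes X :: "('a :: {ring, monoid_mult} mat \<times> 'a mat) set"
  assumes "X \<in> L_set n"
  shows "(X, L_one n) \<in> L_order n"
proof -
  obtain B A where BA: "(B, A) \<in> L_pairs n" and X: "X = L_class n B A"
    using assms by (rule L_setE)
  have d: "dim_col A = n" "dim_row B = dim_row A" using BA by (auto simp: L_pairs_def)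
  have B: "B \<in> carrier_mat (dim_row B) (dim_col B)" and A: "A \<in> carrier_mat (dim_row B) n"
    using d by auto
  have one: "1\<^sub>m 1 * M = M" if "dim_row M = 1" for M :: "'a mat"
    using one_mat_mult_left[of M] that by simp
  have "0\<^sub>m 1 (dim_row B) * B = 1\<^sub>m 1 * 0\<^sub>m 1 (dim_col B)"
    using left_mult_zero_mat[OF B, of 1] one[of "0\<^sub>m 1 (dim_col B)"] by simp
  moreover have "0\<^sub>m 1 (dim_row B) * A = 0\<^sub>m 1 n + 1\<^sub>m 1 * 0\<^sub>m 1 n"
    using left_mult_zero_mat[OF A, of 1] one[of "0\<^sub>m 1 n"]
      left_add_zero_mat[of "0\<^sub>m 1 n :: 'a mat" 1 n] by simp
  moreover have "0\<^sub>m 1 (dim_row B) \<in> carrier_mat (dim_row (1\<^sub>m 1 :: 'a mat)) (dim_row B)"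
    "0\<^sub>m 1 (dim_col B) \<in> carrier_mat (dim_col (1\<^sub>m 1 :: 'a mat)) (dim_col B)"
    "0\<^sub>m 1 n \<in> carrier_mat (dim_col (1\<^sub>m 1 :: 'a mat)) n"
    by auto
  ultimately have "((B, A), (1\<^sub>m 1, 0\<^sub>m 1 n)) \<in> L_preorder n"
    using BA L_one_pair unfolding L_preorder_iff by blast
  then show ?thesis
    unfolding X L_one_def using L_order_class_iff[OF BA L_one_pair] by blast
qed

end

theory Submission
  imports Defs
begin

text \<open>
  Since \<open>1\<^sub>n\<close> is the greatest element, \<open>[B | A] = 1\<^sub>n\<close> just means \<open>(1 | 0) \<le>\<^sub>n (B | A)\<close>
  (\<open>L_class_eq_L_one_iff\<close>). The matrices \<open>U\<close>, \<open>V\<close>, \<open>G\<close> that witness this satisfy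
  \<open>U 1 = B V\<close> and \<open>U 0 = A + B G\<close>. The first equation can
  always be met by \<open>U = 0\<close>, \<open>V = 0\<close>, and in the second one the left-hand side vanishes for every
  \<open>U\<close>. So all that remains is \<open>A + B G = 0\<close> for some \<open>G\<close> (\<open>one_L_preorder_iff\<close>), that is,
  \<open>A = B W\<close> with \<open>W = -G\<close> (\<open>add_mult_eq_zero_mat_iff\<close>).
\<close>

lemma add_mult_eq_zero_mat_iff:
  fixes A B G :: "'a :: ring mat"
  assumes A: "A \<in> carrier_mat m n" and B: "B \<in> carrier_mat m k" and G: "G \<in> carrier_mat k n"
  shows "A + B * G = 0\<^sub>m m n \<longleftrightarrow> B * (- G) = A"
proof -
  have nG: "- G \<in> carrier_mat k n" using G by simp
  have BG: "B * G \<in> carrier_mat m n" and BnG: "B * (- G) \<in> carrier_mat m n"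
    using B G nG by (blast intro: mult_carrier_mat)+
  have cancel: "B * G + B * (- G) = 0\<^sub>m m n"
    using mult_add_distrib_mat[OF B G nG] comm_add_mat[OF G nG] uminus_l_inv_mat[OF G] right_mult_zero_mat[OF B]
    by simp
  show ?thesis
  proof
    assume "A + B * G = 0\<^sub>m m n"
    then have "0\<^sub>m m n + B * (- G) = A + (B * G + B * (- G))"
      using assoc_add_mat[OF A BG BnG] by simp
    then show "B * (- G) = A"
      unfolding cancel left_add_zero_mat[OF BnG] right_add_zero_mat[OF A] .
  next
    assume "B * (- G) = A"
    then show "A + B * G = 0\<^sub>m m n"
      using cancel comm_add_mat[OF BG BnG] by simp
  qed
qed

lemma L_class_eq_L_one_iff:
  assumes BA: "(B, A) \<in> L_pairs n"
  shows "L_class n B A = L_one n \<longleftrightarrow> ((1\<^sub>m 1, 0\<^sub>m 1 n), (B, A)) \<in> L_preorder n"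
proof -
  have "((B, A), (1\<^sub>m 1, 0\<^sub>m 1 n)) \<in> L_preorder n"
    using L_one_greatest[OF L_class_in_L_set[OF BA]] L_order_class_iff[OF BA L_one_pair]
    unfolding L_one_def by blast
  then show ?thesis
    unfolding L_one_def L_class_eq_iff[OF BA L_one_pair] L_equiv_def by blast
qed

text \<open>
  The block \<open>0\<close> of \<open>(1 | 0)\<close> makes the choice of \<open>U\<close> irrelevant to the second equation of
  \<open>(1 | 0) \<le>\<^sub>n (B | A)\<close>, which is why \<open>U\<close> and \<open>V\<close> can be eliminated.
\<close>

lemma one_L_preorder_iff:
  fixes A B :: "'a :: {ring, monoid_mult} mat"
  assumes BA: "(B, A) \<in> L_pairs n"
  shows "((1\<^sub>m 1, 0\<^sub>m 1 n), (B, A)) \<in> L_preorder n \<longleftrightarrow>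
    (\<exists>G \<in> carrier_mat (dim_col B) n. A + B * G = 0\<^sub>m (dim_row B) n)"
    (is "?le \<longleftrightarrow> ?ex")
proof
  assume ?le
  then obtain U G where U: "U \<in> carrier_mat (dim_row B) 1"
    and G: "G \<in> carrier_mat (dim_col B) n" and eq: "U * 0\<^sub>m 1 n = A + B * G"
    unfolding L_preorder_iff by auto
  from eq have "A + B * G = 0\<^sub>m (dim_row B) n"
    unfolding right_mult_zero_mat[OF U] by (rule sym)
  with G show ?ex by blast
next
  assume ?ex
  then obtain G where G: "G \<in> carrier_mat (dim_col B) n"
    and eq: "A + B * G = 0\<^sub>m (dim_row B) n" by blast
  let ?U = "0\<^sub>m (dim_row B) 1 :: 'a mat" and ?V = "0\<^sub>m (dim_col B) 1 :: 'a mat"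
  have B: "B \<in> carrier_mat (dim_row B) (dim_col B)" by simp
  have "?U * 1\<^sub>m 1 = B * ?V"
    unfolding right_mult_zero_mat[OF B] by (rule left_mult_zero_mat) simp
  moreover have "?U * 0\<^sub>m 1 n = A + B * G"
    unfolding eq by (rule left_mult_zero_mat) simp
  moreover have "?U \<in> carrier_mat (dim_row B) (dim_row (1\<^sub>m 1 :: 'a mat))"
    "?V \<in> carrier_mat (dim_col B) (dim_col (1\<^sub>m 1 :: 'a mat))"
    by simp_all
  ultimately show ?le
    using BA L_one_pair G unfolding L_preorder_iff by blast
qed

theorem proposition9:
  fixes A B :: "'a :: {ring, monoid_mult} mat"
    and n :: nat
  assumes "n \<ge> 1"
    and "(B, A) \<in> L_pairs n"
  shows "L_class n B A = L_one n \<longleftrightarrow> (\<exists>W. W \<in> carrier_mat (dim_col B) n \<and> B * W = A)"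
proof -
  have B: "B \<in> carrier_mat (dim_row B) (dim_col B)" and A: "A \<in> carrier_mat (dim_row B) n"
    using assms(2) by (auto simp: L_pairs_def)
  have "L_class n B A = L_one n \<longleftrightarrow>
      (\<exists>G \<in> carrier_mat (dim_col B) n. A + B * G = 0\<^sub>m (dim_row B) n)"
    using assms(2) by (simp only: L_class_eq_L_one_iff one_L_preorder_iff)
  also have "\<dots> \<longleftrightarrow> (\<exists>G \<in> carrier_mat (dim_col B) n. B * (- G) = A)"
    using add_mult_eq_zero_mat_iff[OF A B] by blast
  also have "\<dots> \<longleftrightarrow> (\<exists>W. W \<in> carrier_mat (dim_col B) n \<and> B * W = A)"
    by (metis uminus_carrier_iff_mat uminus_uminus_mat)
  finally show ?thesis .
qed

end
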